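(* If $|Q(u,v)|^2=P(u)R(v)$ for some $Q\in\mathbb{H}_{11}$ and some $P\in\mathbb{R}_{20}$, $R\in\mathbb{R}_{02}$ of degree $2$, then $Q$ is reducible (in $\mathbb{H}[u,v]$).
   Context: $\mathbb{H}$ is the skew field of quaternions. $\mathbb{H}_{mn}\subset\mathbb{H}[u,v]$ (respectively $\mathbb{R}_{mn}\subset\mathbb{R}[u,v]$) is the set of polynomials with quaternionic (respectively real) coefficients of degree at most $m$ in $u$ and at most $n$ in $v$; the variables $u,v$ commute with each other and with the coefficients. $|Q|^2=Q\bar Q\in\mathbb{R}[u,v]$, where $\bar Q$ is obtained by conjugating the coefficients. A polynomial in $\mathbb{H}[u,v]$ is reducible if it is a product of two nonconstant polynomials in $\mathbb{H}[u,v]$. *)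

theory Defs
  imports Complex_Main "HOL-Library.Poly_Mapping" "HOL-Library.Product_Plus"
begin

section \<open>The skew field of quaternions\<close>

datatype quat = Quat (qRe: real) (qI: real) (qJ: real) (qK: real)

lemma quat_eq_iff:
  "x = y \<longleftrightarrow> qRe x = qRe y \<and> qI x = qI y \<and> qJ x = qJ y \<and> qK x = qK y"
  by (auto intro: quat.expand)

instantiation quat :: ab_group_add
begin

definition "0 = Quat 0 0 0 0"
definition "x + y = Quat (qRe x + qRe y) (qI x + qI y) (qJ x + qJ y) (qK x + qK y)"
definition "- x = Quat (- qRe x) (- qI x) (- qJ x) (- qK x)"
definition "x - y = Quat (qRe x - qRe y) (qI x - qI y) (qJ x - qJ y) (qK x - qK y)"

instance
  by standard
    (simp_all add: quat_eq_iff zero_quat_def plus_quat_def uminus_quat_def minus_quat_def)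

end

lemma quat_add_sel [simp]:
  "qRe 0 = 0" "qI 0 = 0" "qJ 0 = 0" "qK 0 = 0"
  "qRe (x + y) = qRe x + qRe y" "qI (x + y) = qI x + qI y"
  "qJ (x + y) = qJ x + qJ y" "qK (x + y) = qK x + qK y"
  "qRe (- x) = - qRe x" "qI (- x) = - qI x" "qJ (- x) = - qJ x" "qK (- x) = - qK x"
  "qRe (x - y) = qRe x - qRe y" "qI (x - y) = qI x - qI y"
  "qJ (x - y) = qJ x - qJ y" "qK (x - y) = qK x - qK y"
  by (simp_all add: zero_quat_def plus_quat_def uminus_quat_def minus_quat_def)

instantiation quat :: real_algebra_1
begin

definition "1 = Quat 1 0 0 0"

definition "x * y = Quat
  (qRe x * qRe y - qI x * qI y - qJ x * qJ y - qK x * qK y)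
  (qRe x * qI y + qI x * qRe y + qJ x * qK y - qK x * qJ y)
  (qRe x * qJ y - qI x * qK y + qJ x * qRe y + qK x * qI y)
  (qRe x * qK y + qI x * qJ y - qJ x * qI y + qK x * qRe y)"

definition "r *\<^sub>R x = Quat (r * qRe x) (r * qI x) (r * qJ x) (r * qK x)"

instance
  by standard
    (simp_all add: quat_eq_iff one_quat_def times_quat_def scaleR_quat_def algebra_simps)

end

lemma quat_mult_sel [simp]:
  "qRe 1 = 1" "qI 1 = 0" "qJ 1 = 0" "qK 1 = 0"
  "qRe (x * y) = qRe x * qRe y - qI x * qI y - qJ x * qJ y - qK x * qK y"
  "qI (x * y) = qRe x * qI y + qI x * qRe y + qJ x * qK y - qK x * qJ y"
  "qJ (x * y) = qRe x * qJ y - qI x * qK y + qJ x * qRe y + qK x * qI y"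
  "qK (x * y) = qRe x * qK y + qI x * qJ y - qJ x * qI y + qK x * qRe y"
  "qRe (r *\<^sub>R x) = r * qRe x" "qI (r *\<^sub>R x) = r * qI x"
  "qJ (r *\<^sub>R x) = r * qJ x" "qK (r *\<^sub>R x) = r * qK x"
  by (simp_all add: one_quat_def times_quat_def scaleR_quat_def)

definition qcnj :: "quat \<Rightarrow> quat" where
  "qcnj x = Quat (qRe x) (- qI x) (- qJ x) (- qK x)"

lemma qcnj_sel [simp]:
  "qRe (qcnj x) = qRe x" "qI (qcnj x) = - qI x" "qJ (qcnj x) = - qJ x" "qK (qcnj x) = - qK x"
  by (simp_all add: qcnj_def)

lemma qcnj_0 [simp]: "qcnj 0 = 0"
  by (simp add: quat_eq_iff)

lemma quat_sum_squares_eq_0_iff: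
  "(qRe x)\<^sup>2 + (qI x)\<^sup>2 + (qJ x)\<^sup>2 + (qK x)\<^sup>2 = 0 \<longleftrightarrow> x = 0"
  by (simp add: quat_eq_iff add_nonneg_eq_0_iff)

lemma quat_mult_qcnj:
  "x * qcnj x = ((qRe x)\<^sup>2 + (qI x)\<^sup>2 + (qJ x)\<^sup>2 + (qK x)\<^sup>2) *\<^sub>R 1"
  "qcnj x * x = ((qRe x)\<^sup>2 + (qI x)\<^sup>2 + (qJ x)\<^sup>2 + (qK x)\<^sup>2) *\<^sub>R 1"
  by (simp_all add: quat_eq_iff power2_eq_square)

instantiation quat :: real_div_algebra
begin

definition "inverse x = inverse ((qRe x)\<^sup>2 + (qI x)\<^sup>2 + (qJ x)\<^sup>2 + (qK x)\<^sup>2) *\<^sub>R qcnj x"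
definition "x div (y::quat) = x * inverse y"

instance
proof
  fix x y :: quat
  show "inverse x * x = 1" "x * inverse x = 1" if "x \<noteq> 0"
    using that quat_sum_squares_eq_0_iff[of x]
    by (simp_all only: inverse_quat_def mult_scaleR_left mult_scaleR_right quat_mult_qcnj)
      simp_all
  show "x div y = x * inverse y"
    by (simp add: divide_quat_def)
  show "inverse (0 :: quat) = 0"
    by (simp add: inverse_quat_def)
qed

end


section \<open>Polynomials in two commuting variables\<close>

text \<open>
  The coefficient of \<open>u\<^sup>i v\<^sup>j\<close> in \<open>p\<close> is \<open>Poly_Mapping.lookup p (i, j)\<close>. Multiplication is convolution, which
  does not require commuting coefficients and lets \<open>u\<close> and \<open>v\<close> commute with each other and with
  the coefficients.
\<close>

type_synonym 'a bipoly = "nat \<times> nat \<Rightarrow>\<^sub>0 'a"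

definition bideg_le :: "nat \<Rightarrow> nat \<Rightarrow> 'a::zero bipoly set" where
  "bideg_le m n = {p. \<forall>(i, j) \<in> Poly_Mapping.keys p. i \<le> m \<and> j \<le> n}"

text \<open>The total degree, with the junk value 0 at the zero polynomial.\<close>

definition total_deg :: "'a::zero bipoly \<Rightarrow> nat" where
  "total_deg p = Max (insert 0 ((\<lambda>(i, j). i + j) ` Poly_Mapping.keys p))"

definition constant_bipoly :: "'a::zero bipoly \<Rightarrow> bool" where
  "constant_bipoly p \<longleftrightarrow> Poly_Mapping.keys p \<subseteq> {(0, 0)}"

definition reducible_bipoly :: "'a::semiring_0 bipoly \<Rightarrow> bool" where
  "reducible_bipoly p \<longleftrightarrow>
     (\<exists>a b. \<not> constant_bipoly a \<and> \<not> constant_bipoly b \<and> p = a * b)"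

definition cnj_bipoly :: "quat bipoly \<Rightarrow> quat bipoly" where
  "cnj_bipoly q = Poly_Mapping.map qcnj q"

definition norm_sq_bipoly :: "quat bipoly \<Rightarrow> quat bipoly" where
  "norm_sq_bipoly q = q * cnj_bipoly q"

text \<open>The inclusion of \<open>\<real>[u,v]\<close> into \<open>\<H>[u,v]\<close>, where \<open>\<H>\<close> denotes the quaternions.\<close>

definition of_real_bipoly :: "real bipoly \<Rightarrow> quat bipoly" where
  "of_real_bipoly p = Poly_Mapping.map of_real p"

end

theory Submission
  imports Defs
begin

text \<open>
  Dividing by the leading coefficient \<open>d\<close>, which is nonzero since \<open>P\<close> and \<open>R\<close> have degree 2, write
  \<open>Q = d (u v + b u + c v + a)\<close>. Comparing coefficients in \<open>|Q|\<^sup>2 = P R\<close> determines the real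
  part of \<open>a\<close>, its scalar products with \<open>b\<close> and \<open>c\<close>, and its norm, in terms of \<open>b\<close> and \<open>c\<close>. After
  translating \<open>u\<close> and \<open>v\<close> so that \<open>b\<close> and \<open>c\<close> are purely imaginary, this says that the imaginary
  part of \<open>a\<close> is orthogonal to \<open>b\<close> and \<open>c\<close> and has the length of \<open>b \<times> c\<close>. Hence it is
  \<open>\<plusminus> b \<times> c\<close>, so \<open>a = b c\<close> or \<open>a = c b\<close>, and \<open>Q\<close> is \<open>d (v + b) (u + c)\<close> or \<open>d (u + c) (v + b)\<close>.
\<close>

text \<open>Orthogonality makes \<open>w\<close> parallel to the cross product \<open>n\<close>, and
  the equal lengths leave only the sign; if \<open>n\<close> vanishes, so does
  \<open>w\<close>.\<close>

lemma orthogonal_eq_cross_or_minus_cross: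
  fixes x1 x2 x3 y1 y2 y3 w1 w2 w3 :: real
  defines "n1 \<equiv> x2 * y3 - x3 * y2" and "n2 \<equiv> x3 * y1 - x1 * y3" and "n3 \<equiv> x1 * y2 - x2 * y1"
  assumes x: "w1 * x1 + w2 * x2 + w3 * x3 = 0"
    and y: "w1 * y1 + w2 * y2 + w3 * y3 = 0"
    and len: "w1\<^sup>2 + w2\<^sup>2 + w3\<^sup>2 = n1\<^sup>2 + n2\<^sup>2 + n3\<^sup>2"
  shows "w1 = n1 \<and> w2 = n2 \<and> w3 = n3 \<or> w1 = - n1 \<and> w2 = - n2 \<and> w3 = - n3"
proof -
  \<comment> \<open>The cross product of \<open>w\<close> and \<open>n\<close> is the triple product
    x (w.y) - y (w.x), which vanishes.\<close>
  have par: "w2 * n3 = w3 * n2" "w3 * n1 = w1 * n3" "w1 * n2 = w2 * n1"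
    using x y unfolding n1_def n2_def n3_def by algebra+
  \<comment> \<open>For |w| = |n| the left side equals 4 (|w|^2 |n|^2 - (w.n)^2), so Lagrange's
    identity covers \<open>n\<close> zero and nonzero at once.\<close>
  have "((w1 - n1)\<^sup>2 + (w2 - n2)\<^sup>2 + (w3 - n3)\<^sup>2) * ((w1 + n1)\<^sup>2 + (w2 + n2)\<^sup>2 + (w3 + n3)\<^sup>2) = 0"
    using par len by algebra
  then have "(w1 - n1)\<^sup>2 + (w2 - n2)\<^sup>2 + (w3 - n3)\<^sup>2 = 0 \<or> (w1 + n1)\<^sup>2 + (w2 + n2)\<^sup>2 + (w3 + n3)\<^sup>2 = 0"
    by simp
  then show ?thesis
    by (auto simp: add_nonneg_eq_0_iff)
qed

text \<open>The products \<open>b * c\<close> and \<open>c * b\<close> differ only in the sign of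
  the cross product of the imaginary parts. The hypotheses are the coefficient equations for u v + b
  u + c v + a, with \<open>P\<close> and \<open>R\<close> eliminated.\<close>

lemma quat_eq_mult_or_mult_commute:
  fixes a b c :: quat
  assumes re: "qRe a + qRe (b * qcnj c) = 2 * qRe b * qRe c"
    and b: "qRe (b * qcnj a) = qRe c * qRe (b * qcnj b)"
    and c: "qRe (c * qcnj a) = qRe b * qRe (c * qcnj c)"
    and len: "qRe (a * qcnj a) = qRe (b * qcnj b) * qRe (c * qcnj c)"
  shows "a = b * c \<or> a = c * b"
proof -
  obtain a0 a1 a2 a3 where a: "a = Quat a0 a1 a2 a3" by (cases a)
  obtain b0 b1 b2 b3 where b': "b = Quat b0 b1 b2 b3" by (cases b)
  obtain c0 c1 c2 c3 where c': "c = Quat c0 c1 c2 c3" by (cases c)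
  \<comment> \<open>This is the imaginary part of \<open>a\<close> after the translation that makes
    \<open>b\<close> and \<open>c\<close> purely imaginary.\<close>
  define w1 w2 w3 where w: "w1 = a1 - b0 * c1 - c0 * b1" "w2 = a2 - b0 * c2 - c0 * b2"
    "w3 = a3 - b0 * c3 - c0 * b3"
  have a_eq: "a1 = w1 + b0 * c1 + c0 * b1" "a2 = w2 + b0 * c2 + c0 * b2"
    "a3 = w3 + b0 * c3 + c0 * b3"
    by (simp_all add: w)
  have a0: "a0 = b0 * c0 - b1 * c1 - b2 * c2 - b3 * c3"
    using re by (simp add: a b' c')
  have ortho: "w1 * b1 + w2 * b2 + w3 * b3 = 0" "w1 * c1 + w2 * c2 + w3 * c3 = 0"
    using b c a0 unfolding a b' c' w by (simp_all add: algebra_simps)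
  have "a0\<^sup>2 + a1\<^sup>2 + a2\<^sup>2 + a3\<^sup>2 = (b0\<^sup>2 + b1\<^sup>2 + b2\<^sup>2 + b3\<^sup>2) * (c0\<^sup>2 + c1\<^sup>2 + c2\<^sup>2 + c3\<^sup>2)"
    using len by (simp add: a b' c' power2_eq_square)
  \<comment> \<open>Both \<open>a\<close> and \<open>b * c\<close> have the same part besides
    \<open>w\<close> and the cross product respectively, and each of these is orthogonal to it, so
    Pythagoras applies.\<close>
  then have "w1\<^sup>2 + w2\<^sup>2 + w3\<^sup>2 =
      (b2 * c3 - b3 * c2)\<^sup>2 + (b3 * c1 - b1 * c3)\<^sup>2 + (b1 * c2 - b2 * c1)\<^sup>2"
    using ortho unfolding a0 a_eq by algebra
  from orthogonal_eq_cross_or_minus_cross[OF ortho this] show ?thesis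
    by (auto simp: a b' c' a0 a_eq quat_eq_iff)
qed

text \<open>\<open>qRe (x * qcnj y)\<close> is the Euclidean inner product, and left multiplication
  by \<open>d\<close> is a similarity.\<close>

lemma qRe_mult_qcnj_mult_left:
  "qRe (d * x * qcnj (d * y)) = qRe (d * qcnj d) * qRe (x * qcnj y)"
  by (simp add: algebra_simps)

abbreviation bimonom :: "nat \<Rightarrow> nat \<Rightarrow> 'a::zero \<Rightarrow> 'a bipoly" where
  "bimonom i j x \<equiv> Poly_Mapping.single (i, j) x"

lemma lookup_eq_0_if_bideg_le:
  assumes "p \<in> bideg_le m n" and "m < i \<or> n < j"
  shows "Poly_Mapping.lookup p (i, j) = 0"
proof (rule ccontr)
  assume "Poly_Mapping.lookup p (i, j) \<noteq> 0"
  then have "(i, j) \<in> Poly_Mapping.keys p"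
    by (simp add: in_keys_iff)
  then show False
    using assms by (auto simp: bideg_le_def)
qed

lemma bideg_le_1_1_expand:
  fixes p :: "'a::comm_monoid_add bipoly"
  assumes "p \<in> bideg_le 1 1"
  obtains d b c a where "p = bimonom 1 1 d + bimonom 1 0 b + bimonom 0 1 c + bimonom 0 0 a"
proof
  show "p = bimonom 1 1 (Poly_Mapping.lookup p (1, 1)) + bimonom 1 0 (Poly_Mapping.lookup p (1, 0))
      + bimonom 0 1 (Poly_Mapping.lookup p (0, 1)) + bimonom 0 0 (Poly_Mapping.lookup p (0, 0))"
  proof (rule poly_mapping_eqI, clarify)
    fix i j :: nat
    consider "1 < i \<or> 1 < j" | "i = 0" "j = 0" | "i = 0" "j = 1" | "i = 1" "j = 0" | "i = 1" "j = 1"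
      by linarith
    then show "Poly_Mapping.lookup p (i, j) = Poly_Mapping.lookup
      (bimonom 1 1 (Poly_Mapping.lookup p (1, 1)) + bimonom 1 0 (Poly_Mapping.lookup p (1, 0))
      + bimonom 0 1 (Poly_Mapping.lookup p (0, 1)) + bimonom 0 0 (Poly_Mapping.lookup p (0, 0))) (i, j)"
      by cases (auto simp: lookup_add lookup_single when_def lookup_eq_0_if_bideg_le[OF assms])
  qed
qed

lemma bideg_le_2_0_expand:
  fixes p :: "'a::comm_monoid_add bipoly"
  assumes "p \<in> bideg_le 2 0"
  shows "p = bimonom 2 0 (Poly_Mapping.lookup p (2, 0)) + bimonom 1 0 (Poly_Mapping.lookup p (1, 0))
    + bimonom 0 0 (Poly_Mapping.lookup p (0, 0))"
proof (rule poly_mapping_eqI, clarify)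
  fix i j :: nat
  consider "2 < i \<or> 0 < j" | "i = 0" "j = 0" | "i = 1" "j = 0" | "i = 2" "j = 0"
    by linarith
  then show "Poly_Mapping.lookup p (i, j) = Poly_Mapping.lookup
    (bimonom 2 0 (Poly_Mapping.lookup p (2, 0)) + bimonom 1 0 (Poly_Mapping.lookup p (1, 0))
    + bimonom 0 0 (Poly_Mapping.lookup p (0, 0))) (i, j)"
    by cases (auto simp: lookup_add lookup_single when_def lookup_eq_0_if_bideg_le[OF assms])
qed

lemma bideg_le_0_2_expand:
  fixes p :: "'a::comm_monoid_add bipoly"
  assumes "p \<in> bideg_le 0 2"
  shows "p = bimonom 0 2 (Poly_Mapping.lookup p (0, 2)) + bimonom 0 1 (Poly_Mapping.lookup p (0, 1))
    + bimonom 0 0 (Poly_Mapping.lookup p (0, 0))"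
proof (rule poly_mapping_eqI, clarify)
  fix i j :: nat
  consider "0 < i \<or> 2 < j" | "i = 0" "j = 0" | "i = 0" "j = 1" | "i = 0" "j = 2"
    by linarith
  then show "Poly_Mapping.lookup p (i, j) = Poly_Mapping.lookup
    (bimonom 0 2 (Poly_Mapping.lookup p (0, 2)) + bimonom 0 1 (Poly_Mapping.lookup p (0, 1))
    + bimonom 0 0 (Poly_Mapping.lookup p (0, 0))) (i, j)"
    by cases (auto simp: lookup_add lookup_single when_def lookup_eq_0_if_bideg_le[OF assms])
qed

text \<open>Positivity of \<open>n\<close> excludes the inserted default 0.\<close>

lemma total_deg_attained:
  assumes "total_deg p = n" "0 < n"
  obtains i j where "i + j = n" "Poly_Mapping.lookup p (i, j) \<noteq> 0"
proof -
  have "total_deg p \<in> insert 0 ((\<lambda>(i, j). i + j) ` Poly_Mapping.keys p)"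
    unfolding total_deg_def by (rule Max_in) auto
  then show thesis
    using assms that by (auto simp: in_keys_iff)
qed

lemma cnj_bipoly_add: "cnj_bipoly (p + q) = cnj_bipoly p + cnj_bipoly q"
  by (rule poly_mapping_eqI)
    (simp add: cnj_bipoly_def lookup_add Poly_Mapping.map.rep_eq when_def quat_eq_iff)

lemma cnj_bipoly_single: "cnj_bipoly (Poly_Mapping.single k x) = Poly_Mapping.single k (qcnj x)"
  by (rule poly_mapping_eqI)
    (simp add: cnj_bipoly_def lookup_single Poly_Mapping.map.rep_eq when_def)

lemma qRe_lookup_of_real_bipoly:
  "qRe (Poly_Mapping.lookup (of_real_bipoly p) k) = Poly_Mapping.lookup p k"
  by (simp add: of_real_bipoly_def Poly_Mapping.map.rep_eq when_def of_real_def)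

text \<open>As the variables commute, swapping the monic factors v + b and u + c changes only the
  constant term, from \<open>b * c\<close> to \<open>c * b\<close>.\<close>

lemma reducible_bipoly_if_leading_factor:
  fixes d b c a :: quat
  assumes "d \<noteq> 0" and "a = b * c \<or> a = c * b"
  shows "reducible_bipoly
    (bimonom 1 1 d + bimonom 1 0 (d * b) + bimonom 0 1 (d * c) + bimonom 0 0 (d * a))"
proof -
  have nonconst: "\<not> constant_bipoly (bimonom 1 0 x + bimonom 0 0 y)"
    "\<not> constant_bipoly (bimonom 0 1 x + bimonom 0 0 y)" if "x \<noteq> 0" for x y :: quat
  proof -
    have "(1, 0) \<in> Poly_Mapping.keys (bimonom 1 0 x + bimonom 0 0 y)"
      "(0, 1) \<in> Poly_Mapping.keys (bimonom 0 1 x + bimonom 0 0 y)"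
      using that by (simp_all add: in_keys_iff lookup_add lookup_single when_def)
    then show "\<not> constant_bipoly (bimonom 1 0 x + bimonom 0 0 y)"
      "\<not> constant_bipoly (bimonom 0 1 x + bimonom 0 0 y)"
      by (auto simp: constant_bipoly_def)
  qed
  from assms(2) show ?thesis
  proof
    assume "a = b * c"
    then have "bimonom 1 1 d + bimonom 1 0 (d * b) + bimonom 0 1 (d * c) + bimonom 0 0 (d * a)
      = (bimonom 0 1 d + bimonom 0 0 (d * b)) * (bimonom 1 0 1 + bimonom 0 0 c)"
      by (simp add: distrib_left distrib_right mult_single mult.assoc)
    then show ?thesis
      unfolding reducible_bipoly_def using nonconst assms(1) zero_neq_one by metis
  next
    assume "a = c * b"
    then have "bimonom 1 1 d + bimonom 1 0 (d * b) + bimonom 0 1 (d * c) + bimonom 0 0 (d * a)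
      = (bimonom 1 0 d + bimonom 0 0 (d * c)) * (bimonom 0 1 1 + bimonom 0 0 b)"
      by (simp add: distrib_left distrib_right mult_single mult.assoc)
    then show ?thesis
      unfolding reducible_bipoly_def using nonconst assms(1) zero_neq_one by metis
  qed
qed

theorem mainTheorem5:
  fixes Q :: "quat bipoly" and P R :: "real bipoly"
  assumes "Q \<in> bideg_le 1 1"
    and "P \<in> bideg_le 2 0" and "total_deg P = 2"
    and "R \<in> bideg_le 0 2" and "total_deg R = 2"
    and "norm_sq_bipoly Q = of_real_bipoly (P * R)"
  shows "reducible_bipoly Q"
proof -
  obtain d b' c' a' where Q: "Q = bimonom 1 1 d + bimonom 1 0 b' + bimonom 0 1 c' + bimonom 0 0 a'"
    using bideg_le_1_1_expand[OF assms(1)] .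
  define p0 p1 p2 where p: "p0 = Poly_Mapping.lookup P (0, 0)" "p1 = Poly_Mapping.lookup P (1, 0)"
    "p2 = Poly_Mapping.lookup P (2, 0)"
  define r0 r1 r2 where r: "r0 = Poly_Mapping.lookup R (0, 0)" "r1 = Poly_Mapping.lookup R (0, 1)"
    "r2 = Poly_Mapping.lookup R (0, 2)"
  have P: "P = bimonom 2 0 p2 + bimonom 1 0 p1 + bimonom 0 0 p0"
    unfolding p by (rule bideg_le_2_0_expand[OF assms(2)])
  have R: "R = bimonom 0 2 r2 + bimonom 0 1 r1 + bimonom 0 0 r0"
    unfolding r by (rule bideg_le_0_2_expand[OF assms(4)])
  have p2: "p2 \<noteq> 0"
  proof -
    obtain i j where "i + j = 2" "Poly_Mapping.lookup P (i, j) \<noteq> 0"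
      using total_deg_attained[OF assms(3)] by auto
    then show ?thesis
      using lookup_eq_0_if_bideg_le[OF assms(2), of i j] p(3) by (cases j) auto
  qed
  have r2: "r2 \<noteq> 0"
  proof -
    obtain i j where "i + j = 2" "Poly_Mapping.lookup R (i, j) \<noteq> 0"
      using total_deg_attained[OF assms(5)] by auto
    then show ?thesis
      using lookup_eq_0_if_bideg_le[OF assms(4), of i j] r(3) by (cases i) auto
  qed
  have coeff: "qRe (Poly_Mapping.lookup (Q * cnj_bipoly Q) k) = Poly_Mapping.lookup (P * R) k" for k
    using assms(6) by (simp add: norm_sq_bipoly_def qRe_lookup_of_real_bipoly)
  note expand = Q P R cnj_bipoly_add cnj_bipoly_single distrib_left distrib_right mult_single
    lookup_add lookup_single when_def
  have sym: "qRe (x * qcnj y) = qRe (y * qcnj x)" for x y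
    by (simp add: algebra_simps)
  \<comment> \<open>Inner products now stay unexpanded, so each coefficient equation is a relation
    between them.\<close>
  note [simp del] = quat_mult_sel(5)
  have dd: "qRe (d * qcnj d) = p2 * r2"
    using coeff[of "(2, 2)"] by (simp add: expand)
  have db: "2 * qRe (d * qcnj b') = p2 * r1"
    using coeff[of "(2, 1)"] by (simp add: expand sym[of b' d])
  have dc: "2 * qRe (d * qcnj c') = p1 * r2"
    using coeff[of "(1, 2)"] by (simp add: expand sym[of c' d])
  have bb: "qRe (b' * qcnj b') = p2 * r0"
    using coeff[of "(2, 0)"] by (simp add: expand)
  have cc: "qRe (c' * qcnj c') = p0 * r2"
    using coeff[of "(0, 2)"] by (simp add: expand)
  have dabc: "2 * qRe (d * qcnj a') + 2 * qRe (b' * qcnj c') = p1 * r1"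
    using coeff[of "(1, 1)"] by (simp add: expand sym[of a' d] sym[of c' b'])
  have ba: "2 * qRe (b' * qcnj a') = p1 * r0"
    using coeff[of "(1, 0)"] by (simp add: expand sym[of a' b'])
  have ca: "2 * qRe (c' * qcnj a') = p0 * r1"
    using coeff[of "(0, 1)"] by (simp add: expand sym[of a' c'])
  have aa: "qRe (a' * qcnj a') = p0 * r0"
    using coeff[of "(0, 0)"] by (simp add: expand)
  \<comment> \<open>By \<open>dd\<close> this is |d|^2, the factor by which normalization rescales
    all inner products.\<close>
  define N where "N = p2 * r2"
  have N: "N \<noteq> 0" using p2 r2 by (simp add: N_def)
  have d: "d \<noteq> 0" using dd N by (auto simp: N_def)
  define a b c where "a = inverse d * a'" "b = inverse d * b'" "c = inverse d * c'"
  then have a': "a' = d * a" and b': "b' = d * b" and c': "c' = d * c"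
    using d by (simp_all flip: mult.assoc)
  have scale: "qRe (d * x * qcnj (d * y)) = N * qRe (x * qcnj y)"
    "qRe (d * qcnj (d * y)) = N * qRe y" for x y
    using qRe_mult_qcnj_mult_left[of d x y] qRe_mult_qcnj_mult_left[of d 1 y]
    by (simp_all add: dd N_def quat_mult_sel(5)[of 1])
  note eqs = db dc bb cc dabc ba ca aa
  note eqs' = eqs[unfolded a' b' c' scale]
  \<comment> \<open>For each hypothesis, multiply two coefficient equations, regroup the right side
    to expose \<open>p2 * r2\<close>, compare with a third equation and cancel
    \<open>N\<close>.\<close>
  have "a = b * c \<or> a = c * b"
  proof (rule quat_eq_mult_or_mult_commute)
    show "qRe a + qRe (b * qcnj c) = 2 * qRe b * qRe c"
      using eqs'(1,2,5) N N_def by algebra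
    show "qRe (b * qcnj a) = qRe c * qRe (b * qcnj b)"
      using eqs'(2,3,6) N N_def by algebra
    show "qRe (c * qcnj a) = qRe b * qRe (c * qcnj c)"
      using eqs'(1,4,7) N N_def by algebra
    show "qRe (a * qcnj a) = qRe (b * qcnj b) * qRe (c * qcnj c)"
      using eqs'(3,4,8) N N_def by algebra
  qed
  then show ?thesis
    using reducible_bipoly_if_leading_factor[OF d] by (simp add: Q a' b' c')
qed

end
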